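(* Let $p\in[1,\infty)$. The space $(\mathcal{M}_p,d_{\mathrm{GH}}^{(p)})$ is $p$-geodesic but is not $q$-geodesic for any $1\le q<p$. In particular, $(\mathcal{M}_p,d_{\mathrm{GH}}^{(p)})$ is not geodesic when $p>1$.
   Context: All metric spaces are nonempty. For $p\in[1,\infty)$, a $p$-metric space is a metric space satisfying $d(x,x'')^p\le d(x,x')^p+d(x',x'')^p$ for all points (a $p$-metric space is also a $q$-metric space for $1\le q\le p$). $\mathcal{M}_p$ is the collection of isometry classes of compact $p$-metric spaces. For metric spaces $X,Y$, $$d_{\mathrm{GH}}^{(p)}(X,Y)=2^{-\frac1p}\inf_R\ \sup_{(x,y),(x',y')\in R}\left|d_X(x,x')^p-d_Y(y,y')^p\right|^{\frac1p},$$ with $R$ ranging over all correspondences between $X$ and $Y$ (subsets of $X\times Y$ projecting onto both factors); this is a $p$-metric on $\mathcal{M}_p$. For $q\in[1,\infty)$ and a $q$-metric space $(W,d_W)$, a continuous curve $\gamma:[0,1]\to W$ is a $q$-geodesic if $d_W(\gamma(s),\gamma(t))=|s-t|^{1/q}\,d_W(\gamma(0),\gamma(1))$ for all $s,t\in[0,1]$; $W$ is $q$-geodesic if any two of its points are joined by a $q$-geodesic. Geodesic means $1$-geodesic. *)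

theory Defs
  imports "HOL-Analysis.Analysis"
begin

section \<open>Definitions\<close>

definition p_metric_space :: "real \<Rightarrow> 'a metric \<Rightarrow> bool" where
  "p_metric_space p X \<longleftrightarrow> mspace X \<noteq> {} \<and>
     (\<forall>x\<in>mspace X. \<forall>x'\<in>mspace X. \<forall>x''\<in>mspace X.
        mdist X x x'' powr p \<le> mdist X x x' powr p + mdist X x' x'' powr p)"

definition compact_p_metrics :: "real \<Rightarrow> 'a metric set" where
  "compact_p_metrics p = {X. p_metric_space p X \<and> compact_space (mtopology_of X)}"

definition isometric :: "'a metric \<Rightarrow> 'b metric \<Rightarrow> bool" where
  "isometric X Y \<longleftrightarrow> (\<exists>f. bij_betw f (mspace X) (mspace Y) \<and>
     (\<forall>x\<in>mspace X. \<forall>x'\<in>mspace X. mdist Y (f x) (f x') = mdist X x x'))"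

text \<open>
  A compact metric space has at most continuum many points, so every isometry class of compact
  \<open>p\<close>-metric spaces has a representative whose points are real numbers; see
  \<open>compact_p_metrics_real_copy\<close> below.  The metric on the carrier is arbitrary and has
  nothing to do with the usual distance of the reals.
\<close>
definition isometry_classes :: "real \<Rightarrow> real metric set set" where
  "isometry_classes p =
     compact_p_metrics p //
       {(X, Y). X \<in> compact_p_metrics p \<and> Y \<in> compact_p_metrics p \<and> isometric X Y}"

definition correspondence :: "('a \<times> 'b) set \<Rightarrow> 'a set \<Rightarrow> 'b set \<Rightarrow> bool" where
  "correspondence R A B \<longleftrightarrow> R \<subseteq> A \<times> B \<and> fst ` R = A \<and> snd ` R = B"

text \<open>
  Infimum and supremum are taken in the reals, which is adequate for bounded spaces (in
  particular for nonempty compact ones): the supremum is then over a nonempty bounded set.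
\<close>
definition GH_dist :: "real \<Rightarrow> 'a metric \<Rightarrow> 'b metric \<Rightarrow> real" where
  "GH_dist p X Y = 2 powr (- 1 / p) *
     (INF R\<in>{R. correspondence R (mspace X) (mspace Y)}.
        SUP ((x, y), (x', y'))\<in>R \<times> R. \<bar>mdist X x x' powr p - mdist Y y y' powr p\<bar> powr (1 / p))"

text \<open>
  The choice of representatives is immaterial (\<open>GH_class_dist_eq\<close> below).  The value \<open>0\<close>
  outside \<open>isometry_classes p\<close> is a dummy, needed because the distance function of an
  \<open>'a metric\<close> is required to be symmetric and nonnegative on the whole type.
\<close>
definition GH_class_dist :: "real \<Rightarrow> real metric set \<Rightarrow> real metric set \<Rightarrow> real" where
  "GH_class_dist p A B =
     (if A \<in> isometry_classes p \<and> B \<in> isometry_classes p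
      then GH_dist p (SOME X. X \<in> A) (SOME Y. Y \<in> B) else 0)"

text \<open>
  That this is a metric, and in fact a \<open>p\<close>-metric, is shown in \<open>mspace_GH_space\<close>,
  \<open>mdist_GH_space\<close> and \<open>p_metric_space_GH_space\<close> below.
\<close>
definition GH_space :: "real \<Rightarrow> real metric set metric" where
  "GH_space p = metric (isometry_classes p, GH_class_dist p)"

definition q_geodesic :: "real \<Rightarrow> 'a metric \<Rightarrow> (real \<Rightarrow> 'a) \<Rightarrow> bool" where
  "q_geodesic q W \<gamma> \<longleftrightarrow>
     continuous_map (top_of_set {0..1}) (mtopology_of W) \<gamma> \<and>
     (\<forall>s\<in>{0..1}. \<forall>t\<in>{0..1}.
        mdist W (\<gamma> s) (\<gamma> t) = \<bar>s - t\<bar> powr (1 / q) * mdist W (\<gamma> 0) (\<gamma> 1))"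

definition q_geodesic_space :: "real \<Rightarrow> 'a metric \<Rightarrow> bool" where
  "q_geodesic_space q W \<longleftrightarrow>
     (\<forall>x\<in>mspace W. \<forall>y\<in>mspace W. \<exists>\<gamma>. q_geodesic q W \<gamma> \<and> \<gamma> 0 = x \<and> \<gamma> 1 = y)"

abbreviation geodesic_space :: "'a metric \<Rightarrow> bool" where
  "geodesic_space W \<equiv> q_geodesic_space 1 W"


section \<open>The definitions are adequate\<close>

subsection \<open>Isometries\<close>

lemma isometric_refl: "isometric X X"
  unfolding isometric_def by (rule exI[of _ id]) auto

lemma isometric_sym:
  assumes "isometric X Y" shows "isometric Y X"
proof -
  obtain f where f: "bij_betw f (mspace X) (mspace Y)"
    and d: "\<And>x x'. x \<in> mspace X \<Longrightarrow> x' \<in> mspace X \<Longrightarrow> mdist Y (f x) (f x') = mdist X x x'"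
    using assms unfolding isometric_def by blast
  let ?g = "inv_into (mspace X) f"
  have g: "bij_betw ?g (mspace Y) (mspace X)"
    using f by (rule bij_betw_inv_into)
  have "mdist X (?g y) (?g y') = mdist Y y y'" if "y \<in> mspace Y" "y' \<in> mspace Y" for y y'
    using d[of "?g y" "?g y'"] that bij_betwE[OF g] bij_betw_inv_into_right[OF f] by simp
  then show ?thesis
    using g unfolding isometric_def by blast
qed

lemma isometric_trans:
  assumes "isometric X Y" "isometric Y Z" shows "isometric X Z"
proof -
  obtain f where f: "bij_betw f (mspace X) (mspace Y)"
    and df: "\<And>x x'. x \<in> mspace X \<Longrightarrow> x' \<in> mspace X \<Longrightarrow> mdist Y (f x) (f x') = mdist X x x'"
    using assms unfolding isometric_def by blast
  obtain g where g: "bij_betw g (mspace Y) (mspace Z)"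
    and dg: "\<And>x x'. x \<in> mspace Y \<Longrightarrow> x' \<in> mspace Y \<Longrightarrow> mdist Z (g x) (g x') = mdist Y x x'"
    using assms unfolding isometric_def by blast
  have "bij_betw (g \<circ> f) (mspace X) (mspace Z)"
    using f g by (rule bij_betw_trans)
  moreover have "mdist Z ((g \<circ> f) x) ((g \<circ> f) x') = mdist X x x'"
    if "x \<in> mspace X" "x' \<in> mspace X" for x x'
    using that df dg f by (simp add: bij_betwE)
  ultimately show ?thesis
    unfolding isometric_def by blast
qed

lemma isometric_compact_p_metrics:
  assumes X: "X \<in> compact_p_metrics p" and iso: "isometric X Y"
  shows "Y \<in> compact_p_metrics p"
proof -
  obtain f where f: "bij_betw f (mspace X) (mspace Y)"
    and d: "\<And>x x'. x \<in> mspace X \<Longrightarrow> x' \<in> mspace X \<Longrightarrow> mdist Y (f x) (f x') = mdist X x x'"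
    using iso unfolding isometric_def by blast
  have im: "f ` mspace X = mspace Y"
    using f by (simp add: bij_betw_def)
  interpret Metric_space12 "mspace X" "mdist X" "mspace Y" "mdist Y"
    by (simp add: Metric_space12_def)
  have "homeomorphic_map (mtopology_of X) (mtopology_of Y) f"
    using isometry_imp_homeomorphic_map[OF im d] by (simp add: mtopology_of_def)
  then have "compact_space (mtopology_of Y)"
    using X homeomorphic_compact_space homeomorphic_map_imp_homeomorphic_space
    unfolding compact_p_metrics_def by blast
  moreover have "p_metric_space p Y"
    using X d unfolding compact_p_metrics_def p_metric_space_def im[symmetric] by auto
  ultimately show ?thesis
    by (simp add: compact_p_metrics_def)
qed

theorem compact_p_metrics_real_copy:
  fixes X :: "'a metric"
  assumes X: "X \<in> compact_p_metrics p"
  obtains Y :: "real metric" where "Y \<in> compact_p_metrics p" "isometric X Y"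
proof -
  interpret Metric_space "mspace X" "mdist X"
    by simp
  have "mtotally_bounded (mspace X)"
    using X compact_space_eq_mcomplete_mtotally_bounded
    by (auto simp: compact_p_metrics_def mtopology_of_def)
  then have "\<forall>n. \<exists>K. finite K \<and> K \<subseteq> mspace X \<and>
      mspace X \<subseteq> (\<Union>x\<in>K. mball x (inverse (Suc n)))"
    unfolding mtotally_bounded_def by simp
  then obtain K where K: "\<And>n. finite (K n)" "\<And>n. K n \<subseteq> mspace X"
      "\<And>n. mspace X \<subseteq> (\<Union>x\<in>K n. mball x (inverse (Suc n)))"
    by metis
  define D where "D = (\<Union>n. K n)"
  have cD: "countable D"
    unfolding D_def using K by (auto intro: countable_finite)
  have DX: "D \<subseteq> mspace X"
    using K by (auto simp: D_def)
  have dense: "\<exists>a\<in>D. mdist X x a < e" if x: "x \<in> mspace X" and e: "e > 0" for x e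
  proof -
    obtain n where n: "inverse (real (Suc n)) < e"
      using e reals_Archimedean by blast
    obtain a where "a \<in> K n" "x \<in> mball a (inverse (Suc n))"
      using K(3) x by blast
    then show ?thesis
      using n commute by (intro bexI[of _ a]) (auto simp: D_def)
  qed
  define c where "c = (\<lambda>x. to_nat_on (D \<times> (UNIV :: rat set)) `
      {(a, r). a \<in> D \<and> mdist X x a < of_rat r})"
  have cDQ: "countable (D \<times> (UNIV :: rat set))"
    using cD by auto
  have inj_c: "inj_on c (mspace X)"
  proof (rule inj_onI, rule ccontr)
    fix x y assume x: "x \<in> mspace X" and y: "y \<in> mspace X" and eq: "c x = c y" and ne: "x \<noteq> y"
    have "{(a, r). a \<in> D \<and> mdist X x a < of_rat r} = {(a, r :: rat). a \<in> D \<and> mdist X y a < of_rat r}"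
      using inj_on_image_eq_iff[OF inj_on_to_nat_on[OF cDQ],
          of "{(a, r). a \<in> D \<and> mdist X x a < of_rat r}" "{(a, r). a \<in> D \<and> mdist X y a < of_rat r}"]
        eq unfolding c_def by auto
    then have iff: "mdist X x a < of_rat r \<longleftrightarrow> mdist X y a < of_rat r" if "a \<in> D" for a and r :: rat
      using that by (auto simp: set_eq_iff)
    have pos: "mdist X x y / 2 > 0"
      using ne x y mdist_pos_less[of x y] by simp
    obtain a where a: "a \<in> D" "mdist X x a < mdist X x y / 2"
      using dense[OF x pos] by blast
    obtain r :: rat where r: "mdist X x a < of_rat r" "of_rat r < mdist X x y / 2"
      using of_rat_dense[OF a(2)] by blast
    then have "mdist X y a < mdist X x y / 2"
      using iff[OF a(1)] by force
    then show False
      using a triangle[of x a y] x y DX commute[of a y] by force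
  qed
  obtain h :: "nat set \<Rightarrow> real" where h: "bij h"
    using nat_sets_eqpoll_reals unfolding eqpoll_def by auto
  define \<phi> where "\<phi> = h \<circ> c"
  have inj: "inj_on \<phi> (mspace X)"
    unfolding \<phi>_def using inj_c h by (intro comp_inj_on) (auto simp: bij_def intro: inj_on_subset)
  define d where "d = (\<lambda>u v. mdist X (inv_into (mspace X) \<phi> u) (inv_into (mspace X) \<phi> v))"
  interpret Y: Metric_space "\<phi> ` mspace X" d
  proof
    show "0 \<le> d x y" "d x y = d y x" for x y
      by (auto simp: d_def commute)
    show "d x y = 0 \<longleftrightarrow> x = y" if "x \<in> \<phi> ` mspace X" "y \<in> \<phi> ` mspace X" for x y
      using that inj by (auto simp: d_def)
    show "d x z \<le> d x y + d y z"
      if "x \<in> \<phi> ` mspace X" "y \<in> \<phi> ` mspace X" "z \<in> \<phi> ` mspace X" for x y z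
      using that inj by (auto simp: d_def intro: triangle)
  qed
  have iso: "isometric X (metric (\<phi> ` mspace X, d))"
    unfolding isometric_def Y.mspace_metric Y.mdist_metric
    using inj by (intro exI[of _ \<phi>]) (auto simp: bij_betw_def d_def)
  show ?thesis
    using that[OF isometric_compact_p_metrics[OF X iso] iso] .
qed

lemma equiv_isometry:
  "equiv (compact_p_metrics p)
     {(X, Y). X \<in> compact_p_metrics p \<and> Y \<in> compact_p_metrics p \<and> isometric X Y}"
  (is "equiv ?K ?r")
proof (rule equivI)
  show "?r \<subseteq> ?K \<times> ?K"
    by auto
  show "refl_on ?K ?r"
    by (simp add: refl_on_def isometric_refl)
  show "sym ?r"
    by (rule symI) (simp add: isometric_sym)
  show "trans ?r"
    by (rule transI, clarsimp, rule isometric_trans)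
qed


subsection \<open>Basic properties of the Gromov-Hausdorff distance\<close>

lemma correspondence_iff:
  "correspondence R A B \<longleftrightarrow> R \<subseteq> A \<times> B \<and> (\<forall>x\<in>A. \<exists>y. (x, y) \<in> R) \<and> (\<forall>y\<in>B. \<exists>x. (x, y) \<in> R)"
  unfolding correspondence_def fst_eq_Domain snd_eq_Range by blast

lemma correspondence_converse:
  "correspondence R A B \<Longrightarrow> correspondence (R\<inverse>) B A"
  unfolding correspondence_iff by blast

lemma correspondence_O:
  "correspondence R A B \<Longrightarrow> correspondence S B C \<Longrightarrow> correspondence (R O S) A C"
  unfolding correspondence_iff by blast

lemma correspondence_nonempty: "correspondence R A B \<Longrightarrow> A \<noteq> {} \<Longrightarrow> R \<noteq> {}"
  unfolding correspondence_def by auto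

lemma correspondence_Times:
  "A \<noteq> {} \<Longrightarrow> B \<noteq> {} \<Longrightarrow> correspondence (A \<times> B) A B"
  unfolding correspondence_iff by blast

lemma compact_p_metrics_bounded:
  assumes "X \<in> compact_p_metrics p"
  obtains B where "\<And>x x'. x \<in> mspace X \<Longrightarrow> x' \<in> mspace X \<Longrightarrow> mdist X x x' \<le> B"
proof -
  interpret Metric_space "mspace X" "mdist X"
    by simp
  have "mbounded (mspace X)"
    using assms compactin_imp_mbounded[of "mspace X"]
    by (simp add: compact_p_metrics_def mtopology_of_def compact_space_def)
  then obtain B where "\<forall>x\<in>mspace X. \<forall>x'\<in>mspace X. mdist X x x' \<le> B"
    unfolding mbounded_alt by blast
  then show ?thesis
    by (intro that[of B]) blast
qed

lemma compact_p_metrics_nonempty: "X \<in> compact_p_metrics p \<Longrightarrow> mspace X \<noteq> {}"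
  by (simp add: compact_p_metrics_def p_metric_space_def)

lemma distortion_bdd_above:
  assumes p: "1 \<le> p" and X: "X \<in> compact_p_metrics p" and Y: "Y \<in> compact_p_metrics p"
    and R: "correspondence R (mspace X) (mspace Y)"
  shows "bdd_above ((\<lambda>((x, y), (x', y')).
            \<bar>mdist X x x' powr p - mdist Y y y' powr p\<bar> powr (1 / p)) ` (R \<times> R))"
proof -
  obtain B where B: "\<And>x x'. x \<in> mspace X \<Longrightarrow> x' \<in> mspace X \<Longrightarrow> mdist X x x' \<le> B"
    using compact_p_metrics_bounded[OF X] by blast
  obtain C where C: "\<And>x x'. x \<in> mspace Y \<Longrightarrow> x' \<in> mspace Y \<Longrightarrow> mdist Y x x' \<le> C"
    using compact_p_metrics_bounded[OF Y] by blast
  have "\<bar>mdist X x x' powr p - mdist Y y y' powr p\<bar> powr (1 / p)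
      \<le> (B powr p + C powr p) powr (1 / p)" if "(x, y) \<in> R" "(x', y') \<in> R" for x y x' y'
  proof -
    have m: "x \<in> mspace X" "x' \<in> mspace X" "y \<in> mspace Y" "y' \<in> mspace Y"
      using that R by (auto simp: correspondence_def)
    have "mdist X x x' powr p \<le> B powr p" "mdist Y y y' powr p \<le> C powr p"
      using B C m p by (auto intro!: powr_mono2)
    then have "\<bar>mdist X x x' powr p - mdist Y y y' powr p\<bar> \<le> B powr p + C powr p"
      by (smt (verit) powr_ge_zero)
    then show ?thesis
      using p by (intro powr_mono2) auto
  qed
  then show ?thesis
    by (intro bdd_aboveI) auto
qed

lemma distortion_nonneg:
  assumes "1 \<le> p" "X \<in> compact_p_metrics p" "Y \<in> compact_p_metrics p"
    and R: "correspondence R (mspace X) (mspace Y)"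
  shows "0 \<le> (SUP ((x, y), (x', y'))\<in>R \<times> R.
            \<bar>mdist X x x' powr p - mdist Y y y' powr p\<bar> powr (1 / p))"
proof -
  obtain z where "z \<in> R"
    using correspondence_nonempty[OF R compact_p_metrics_nonempty[OF assms(2)]] by blast
  then show ?thesis
    using distortion_bdd_above[OF assms]
    by (intro cSUP_upper2[of _ _ "(z, z)"]) (auto split: prod.splits)
qed

lemma GH_dist_nonneg:
  assumes "1 \<le> p" "X \<in> compact_p_metrics p" "Y \<in> compact_p_metrics p"
  shows "0 \<le> GH_dist p X Y"
proof -
  have "correspondence (mspace X \<times> mspace Y) (mspace X) (mspace Y)"
    using assms by (simp add: correspondence_Times compact_p_metrics_nonempty)
  then have "0 \<le> (INF R\<in>{R. correspondence R (mspace X) (mspace Y)}.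
        SUP ((x, y), (x', y'))\<in>R \<times> R. \<bar>mdist X x x' powr p - mdist Y y y' powr p\<bar> powr (1 / p))"
    using distortion_nonneg[OF assms] by (intro cINF_greatest) auto
  then show ?thesis
    by (simp add: GH_dist_def)
qed

lemma GH_dist_le:
  assumes p: "1 \<le> p" and X: "X \<in> compact_p_metrics p" and Y: "Y \<in> compact_p_metrics p"
    and R: "correspondence R (mspace X) (mspace Y)" and r: "0 \<le> r"
    and le: "\<And>x y x' y'. (x, y) \<in> R \<Longrightarrow> (x', y') \<in> R \<Longrightarrow>
               \<bar>mdist X x x' powr p - mdist Y y y' powr p\<bar> \<le> 2 * r powr p"
  shows "GH_dist p X Y \<le> r"
proof -
  have ne: "R \<noteq> {}"
    using correspondence_nonempty[OF R compact_p_metrics_nonempty[OF X]] .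
  have "(INF R\<in>{R. correspondence R (mspace X) (mspace Y)}.
        SUP ((x, y), (x', y'))\<in>R \<times> R. \<bar>mdist X x x' powr p - mdist Y y y' powr p\<bar> powr (1 / p))
      \<le> (SUP ((x, y), (x', y'))\<in>R \<times> R. \<bar>mdist X x x' powr p - mdist Y y y' powr p\<bar> powr (1 / p))"
    using R distortion_nonneg[OF p X Y] by (intro cINF_lower bdd_belowI2[of _ 0]) auto
  also have "\<dots> \<le> 2 powr (1 / p) * r"
  proof -
    have "\<bar>mdist X x x' powr p - mdist Y y y' powr p\<bar> powr (1 / p) \<le> 2 powr (1 / p) * r"
      if "(x, y) \<in> R" "(x', y') \<in> R" for x y x' y'
    proof -
      have "\<bar>mdist X x x' powr p - mdist Y y y' powr p\<bar> powr (1 / p) \<le> (2 * r powr p) powr (1 / p)"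
        using le[OF that] p by (intro powr_mono2) auto
      also have "\<dots> = 2 powr (1 / p) * r"
        using p r by (simp add: powr_mult powr_powr)
      finally show ?thesis .
    qed
    then show ?thesis
      using ne by (intro cSUP_least) auto
  qed
  finally have "GH_dist p X Y \<le> 2 powr (- 1 / p) * (2 powr (1 / p) * r)"
    unfolding GH_dist_def by (intro mult_left_mono) auto
  also have "\<dots> = r"
    by (simp add: mult.assoc[symmetric] powr_add[symmetric])
  finally show ?thesis .
qed

lemma GH_dist_less:
  assumes p: "1 \<le> p" and X: "X \<in> compact_p_metrics p" and Y: "Y \<in> compact_p_metrics p"
    and less: "GH_dist p X Y < r"
  obtains R where "correspondence R (mspace X) (mspace Y)"
    "\<And>x y x' y'. (x, y) \<in> R \<Longrightarrow> (x', y') \<in> R \<Longrightarrow>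
        \<bar>mdist X x x' powr p - mdist Y y y' powr p\<bar> \<le> 2 * r powr p"
proof -
  let ?D = "\<lambda>R. SUP ((x, y), (x', y'))\<in>R \<times> R.
      \<bar>mdist X x x' powr p - mdist Y y y' powr p\<bar> powr (1 / p)"
  let ?C = "{R. correspondence R (mspace X) (mspace Y)}"
  have r: "r \<ge> 0"
    using less GH_dist_nonneg[OF p X Y] by linarith
  have "mspace X \<times> mspace Y \<in> ?C"
    using X Y by (simp add: correspondence_Times compact_p_metrics_nonempty)
  then have ne: "?C \<noteq> {}"
    by blast
  have bdd: "bdd_below (?D ` ?C)"
    using distortion_nonneg[OF p X Y] by (intro bdd_belowI2[of _ 0]) auto
  have "2 powr (1 / p) * (2 powr (- 1 / p) * (INF R\<in>?C. ?D R)) < 2 powr (1 / p) * r"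
    using less unfolding GH_dist_def by (intro mult_strict_left_mono) auto
  then have "(INF R\<in>?C. ?D R) < 2 powr (1 / p) * r"
    by (simp add: mult.assoc[symmetric] powr_add[symmetric])
  then obtain R where R: "correspondence R (mspace X) (mspace Y)" and DR: "?D R < 2 powr (1 / p) * r"
    using cINF_less_iff[OF ne bdd] by auto
  have "\<bar>mdist X x x' powr p - mdist Y y y' powr p\<bar> \<le> 2 * r powr p"
    if xy: "(x, y) \<in> R" "(x', y') \<in> R" for x y x' y'
  proof -
    have "\<bar>mdist X x x' powr p - mdist Y y y' powr p\<bar> powr (1 / p) \<le> ?D R"
      using xy by (intro cSUP_upper2[OF distortion_bdd_above[OF p X Y R], of "((x, y), (x', y'))"]) auto
    with DR have "\<bar>mdist X x x' powr p - mdist Y y y' powr p\<bar> powr (1 / p) \<le> 2 powr (1 / p) * r"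
      by linarith
    then have "(\<bar>mdist X x x' powr p - mdist Y y y' powr p\<bar> powr (1 / p)) powr p
        \<le> (2 powr (1 / p) * r) powr p"
      using p by (intro powr_mono2) auto
    then show ?thesis
      using p r by (simp add: powr_mult powr_powr)
  qed
  then show ?thesis
    using that R by blast
qed

lemma GH_dist_commute_le:
  assumes p: "1 \<le> p" and X: "X \<in> compact_p_metrics p" and Y: "Y \<in> compact_p_metrics p"
  shows "GH_dist p X Y \<le> GH_dist p Y X"
proof (rule dense_ge)
  fix r assume r: "GH_dist p Y X < r"
  obtain R where R: "correspondence R (mspace Y) (mspace X)"
    "\<And>x y x' y'. (x, y) \<in> R \<Longrightarrow> (x', y') \<in> R \<Longrightarrow>
        \<bar>mdist Y x x' powr p - mdist X y y' powr p\<bar> \<le> 2 * r powr p"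
    using GH_dist_less[OF p Y X r] by blast
  show "GH_dist p X Y \<le> r"
  proof (rule GH_dist_le[OF p X Y correspondence_converse[OF R(1)]])
    show "0 \<le> r"
      using r GH_dist_nonneg[OF p Y X] by linarith
    show "\<bar>mdist X x x' powr p - mdist Y y y' powr p\<bar> \<le> 2 * r powr p"
      if "(x, y) \<in> R\<inverse>" "(x', y') \<in> R\<inverse>" for x y x' y'
      using R(2)[of y x y' x'] that by (simp add: abs_minus_commute)
  qed
qed

lemma GH_dist_commute:
  assumes "1 \<le> p" "X \<in> compact_p_metrics p" "Y \<in> compact_p_metrics p"
  shows "GH_dist p X Y = GH_dist p Y X"
  using GH_dist_commute_le[OF assms] GH_dist_commute_le[OF assms(1,3,2)] by linarith

lemma GH_dist_triangle:
  assumes p: "1 \<le> p" and X: "X \<in> compact_p_metrics p" and Y: "Y \<in> compact_p_metrics p"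
    and Z: "Z \<in> compact_p_metrics p"
  shows "GH_dist p X Z powr p \<le> GH_dist p X Y powr p + GH_dist p Y Z powr p"
proof -
  have tri: "\<bar>a - c\<bar> \<le> \<bar>a - b\<bar> + \<bar>b - c\<bar>" for a b c :: real
    by linarith
  have main: "GH_dist p X Z powr p \<le> (GH_dist p X Y + e) powr p + (GH_dist p Y Z + e) powr p"
    if e: "e > 0" for e
  proof -
    let ?a = "GH_dist p X Y + e" and ?b = "GH_dist p Y Z + e"
    have a: "GH_dist p X Y < ?a" and b: "GH_dist p Y Z < ?b"
      using e by simp_all
    let ?r = "(?a powr p + ?b powr p) powr (1 / p)"
    obtain R where R: "correspondence R (mspace X) (mspace Y)"
      "\<And>x y x' y'. (x, y) \<in> R \<Longrightarrow> (x', y') \<in> R \<Longrightarrow>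
          \<bar>mdist X x x' powr p - mdist Y y y' powr p\<bar> \<le> 2 * ?a powr p"
      using GH_dist_less[OF p X Y a] by blast
    obtain S where S: "correspondence S (mspace Y) (mspace Z)"
      "\<And>x y x' y'. (x, y) \<in> S \<Longrightarrow> (x', y') \<in> S \<Longrightarrow>
          \<bar>mdist Y x x' powr p - mdist Z y y' powr p\<bar> \<le> 2 * ?b powr p"
      using GH_dist_less[OF p Y Z b] by blast
    have rp: "?r powr p = ?a powr p + ?b powr p"
      using p by (simp add: powr_powr)
    have "GH_dist p X Z \<le> ?r"
    proof (rule GH_dist_le[OF p X Z correspondence_O[OF R(1) S(1)]])
      show "\<bar>mdist X x x' powr p - mdist Z z z' powr p\<bar> \<le> 2 * ?r powr p"
        if "(x, z) \<in> R O S" "(x', z') \<in> R O S" for x z x' z'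
      proof -
        obtain y y' where y: "(x, y) \<in> R" "(y, z) \<in> S" "(x', y') \<in> R" "(y', z') \<in> S"
          using \<open>(x, z) \<in> R O S\<close> \<open>(x', z') \<in> R O S\<close> by blast
        show ?thesis
          unfolding rp distrib_left
          by (rule order_trans[OF tri add_mono[OF R(2)[OF y(1,3)] S(2)[OF y(2,4)]]])
      qed
    qed auto
    then have "GH_dist p X Z powr p \<le> ?r powr p"
      using p GH_dist_nonneg[OF p X Z] by (intro powr_mono2) auto
    then show ?thesis
      by (simp only: rp)
  qed
  have "((\<lambda>e. (GH_dist p X Y + e) powr p + (GH_dist p Y Z + e) powr p) \<longlongrightarrow>
      (GH_dist p X Y + 0) powr p + (GH_dist p Y Z + 0) powr p) (at_right 0)"
    using p GH_dist_nonneg[OF p X Y] GH_dist_nonneg[OF p Y Z]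
    by (intro tendsto_add tendsto_powr' tendsto_const tendsto_ident_at
        eventually_mono[OF eventually_at_right_less[of "0 :: real"]] disjI2 conjI) auto
  moreover have "\<forall>\<^sub>F e in at_right 0.
      GH_dist p X Z powr p \<le> (GH_dist p X Y + e) powr p + (GH_dist p Y Z + e) powr p"
    by (rule eventually_mono[OF eventually_at_right_less main])
  ultimately have "GH_dist p X Z powr p \<le> (GH_dist p X Y + 0) powr p + (GH_dist p Y Z + 0) powr p"
    by (rule tendsto_lowerbound) simp
  then show ?thesis
    by simp
qed

lemma powr_powr_cancel: "1 \<le> p \<Longrightarrow> 0 \<le> a \<Longrightarrow> (a powr p) powr (1 / p) = a" for a p :: real
  by (simp add: powr_powr)

lemma powr_powr_inverse:
  fixes a b p :: real
  assumes "1 \<le> p" "0 \<le> a" "0 \<le> b" "a powr p = b powr p"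
  shows "a = b"
proof -
  have "a = (a powr p) powr (1 / p)"
    using powr_powr_cancel[OF assms(1,2)] by (rule sym)
  also have "\<dots> = (b powr p) powr (1 / p)"
    by (simp only: assms(4))
  also have "\<dots> = b"
    using assms(1,3) by (rule powr_powr_cancel)
  finally show ?thesis .
qed

lemma GH_dist_eq_0:
  assumes p: "1 \<le> p" and X: "X \<in> compact_p_metrics p" and Y: "Y \<in> compact_p_metrics p"
    and iso: "isometric X Y"
  shows "GH_dist p X Y = 0"
proof -
  obtain f where f: "bij_betw f (mspace X) (mspace Y)"
    and d: "\<And>x x'. x \<in> mspace X \<Longrightarrow> x' \<in> mspace X \<Longrightarrow> mdist Y (f x) (f x') = mdist X x x'"
    using iso unfolding isometric_def by blast
  have "correspondence ((\<lambda>x. (x, f x)) ` mspace X) (mspace X) (mspace Y)"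
    using f by (auto simp: correspondence_def bij_betw_def image_image)
  then have "GH_dist p X Y \<le> 0"
    by (rule GH_dist_le[OF p X Y]) (auto simp: d)
  then show ?thesis
    using GH_dist_nonneg[OF p X Y] by linarith
qed

text \<open>
  Almost isometric pairs of maps back and forth form a decreasing sequence of nonempty closed
  subsets of a compact product space, so they have a common element.
\<close>
lemma GH_dist_eq_0_imp_isometric:
  assumes p: "1 \<le> p" and X: "X \<in> compact_p_metrics p" and Y: "Y \<in> compact_p_metrics p"
    and zero: "GH_dist p X Y = 0"
  shows "isometric X Y"
proof -
  have p0: "0 < p"
    using p by linarith
  define \<psi> where "\<psi> = (\<lambda>t :: real. max 0 t powr p)"
  have cont_\<psi>: "continuous_map euclideanreal euclideanreal \<psi>"
  proof -
    have "continuous_on UNIV \<psi>"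
      unfolding \<psi>_def using p0 by (intro continuous_on_powr' continuous_on_max
          continuous_on_const continuous_on_id) auto
    then show ?thesis
      by simp
  qed
  define T where "T = prod_topology (product_topology (\<lambda>_. mtopology_of Y) (mspace X))
                                    (product_topology (\<lambda>_. mtopology_of X) (mspace Y))"
  have T: "compact_space T"
    using X Y by (simp add: T_def compact_p_metrics_def compact_space_prod_topology
        compact_space_product_topology)
  have topT: "topspace T = (mspace X \<rightarrow>\<^sub>E mspace Y) \<times> (mspace Y \<rightarrow>\<^sub>E mspace X)"
    by (simp add: T_def)
  have cf: "continuous_map T (mtopology_of Y) (\<lambda>z. fst z x)" if "x \<in> mspace X" for x
    using continuous_map_compose[OF continuous_map_fst continuous_map_product_projection[OF that]]
    unfolding T_def o_def by fast
  have cg: "continuous_map T (mtopology_of X) (\<lambda>z. snd z y)" if "y \<in> mspace Y" for y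
    using continuous_map_compose[OF continuous_map_snd continuous_map_product_projection[OF that]]
    unfolding T_def o_def by fast
  have cpow: "continuous_map T euclideanreal (\<lambda>z. mdist W (u z) (v z) powr p)"
    if "continuous_map T (mtopology_of W) u" "continuous_map T (mtopology_of W) v"
    for W :: "'c metric" and u v
    using continuous_map_compose[OF continuous_map_mdist[OF that] cont_\<psi>]
    by (simp add: o_def \<psi>_def)
  define F where "F = (\<lambda>x x' (z :: ('a \<Rightarrow> 'b) \<times> ('b \<Rightarrow> 'a)).
      mdist X x x' powr p - mdist Y (fst z x) (fst z x') powr p)"
  define G where "G = (\<lambda>x y (z :: ('a \<Rightarrow> 'b) \<times> ('b \<Rightarrow> 'a)).
      mdist X x (snd z y) powr p - mdist Y (fst z x) y powr p)"
  have cF: "continuous_map T euclideanreal (F x x')" if "x \<in> mspace X" "x' \<in> mspace X" for x x'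
    unfolding F_def using that
    by (intro continuous_map_diff cpow cf cg) (simp_all add: continuous_map_const)
  have cG: "continuous_map T euclideanreal (G x y)" if "x \<in> mspace X" "y \<in> mspace Y" for x y
    unfolding G_def using that
    by (intro continuous_map_diff cpow cf cg) (simp_all add: continuous_map_const)
  define C where "C = (\<lambda>n. {z \<in> topspace T.
      (\<forall>x\<in>mspace X. \<forall>x'\<in>mspace X. \<bar>F x x' z\<bar> \<le> 2 * inverse (Suc n) powr p) \<and>
      (\<forall>x\<in>mspace X. \<forall>y\<in>mspace Y. \<bar>G x y z\<bar> \<le> 2 * inverse (Suc n) powr p)})"
  obtain x0 where x0: "x0 \<in> mspace X"
    using compact_p_metrics_nonempty[OF X] by blast
  obtain y0 where y0: "y0 \<in> mspace Y"
    using compact_p_metrics_nonempty[OF Y] by blast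
  have "closedin T (C n)" for n
  proof -
    let ?e = "2 * inverse (Suc n) powr p"
    have pre: "closedin T {z \<in> topspace T. \<bar>h z\<bar> \<le> ?e}" if "continuous_map T euclideanreal h" for h
    proof -
      have "{z \<in> topspace T. \<bar>h z\<bar> \<le> ?e} = {z \<in> topspace T. h z \<in> {-?e..?e}}"
        by auto
      then show ?thesis
        using closedin_continuous_map_preimage[OF that, of "{-?e..?e}"] by simp
    qed
    have "C n = (\<Inter>x\<in>mspace X. \<Inter>x'\<in>mspace X. {z \<in> topspace T. \<bar>F x x' z\<bar> \<le> ?e}) \<inter>
                (\<Inter>x\<in>mspace X. \<Inter>y\<in>mspace Y. {z \<in> topspace T. \<bar>G x y z\<bar> \<le> ?e})"
      using x0 y0 unfolding C_def by auto
    also have "closedin T \<dots>"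
      using x0 y0 by (intro closedin_Int closedin_INT pre cF cG) auto
    finally show ?thesis .
  qed
  moreover have "C n \<noteq> {}" for n
  proof -
    have lt: "GH_dist p X Y < inverse (Suc n)"
      using zero by simp
    then obtain R where R: "correspondence R (mspace X) (mspace Y)"
      "\<And>x y x' y'. (x, y) \<in> R \<Longrightarrow> (x', y') \<in> R \<Longrightarrow>
          \<bar>mdist X x x' powr p - mdist Y y y' powr p\<bar> \<le> 2 * inverse (Suc n) powr p"
      using GH_dist_less[OF p X Y lt] by blast
    have "\<forall>x\<in>mspace X. \<exists>y. (x, y) \<in> R" "\<forall>y\<in>mspace Y. \<exists>x. (x, y) \<in> R"
      using R(1) unfolding correspondence_iff by blast+
    then obtain f g where f: "\<And>x. x \<in> mspace X \<Longrightarrow> (x, f x) \<in> R"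
      and g: "\<And>y. y \<in> mspace Y \<Longrightarrow> (g y, y) \<in> R"
      by metis
    have "f x \<in> mspace Y" if "x \<in> mspace X" for x
      using f[OF that] R(1) by (auto simp: correspondence_def)
    moreover have "g y \<in> mspace X" if "y \<in> mspace Y" for y
      using g[OF that] R(1) by (auto simp: correspondence_def)
    ultimately have "(restrict f (mspace X), restrict g (mspace Y)) \<in> C n"
      unfolding C_def F_def G_def topT using R(2) f g by auto
    then show ?thesis
      by blast
  qed
  moreover have "decseq C"
  proof (rule decseq_SucI)
    fix n
    have "2 * inverse (real (Suc (Suc n))) powr p \<le> 2 * inverse (real (Suc n)) powr p"
      using p by (intro mult_left_mono powr_mono2 le_imp_inverse_le) auto
    then show "C (Suc n) \<subseteq> C n"
      unfolding C_def by (blast intro: order_trans)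
  qed
  ultimately have "(\<Inter>n. C n) \<noteq> {}"
    by (intro compact_space_imp_nest[OF T])
  then obtain f g where fg: "\<And>n. (f, g) \<in> C n"
    by fast
  have lim: "(\<lambda>n. 2 * inverse (real (Suc n)) powr p) \<longlonglongrightarrow> 0"
  proof -
    have "(\<lambda>n. 2 * inverse (real (Suc n)) powr p) \<longlonglongrightarrow> 2 * 0 powr p"
      using p by (intro tendsto_intros tendsto_powr' LIMSEQ_inverse_real_of_nat) auto
    then show ?thesis
      by simp
  qed
  have null: "h = 0" if "\<And>n. \<bar>h\<bar> \<le> 2 * inverse (real (Suc n)) powr p" for h :: real
    using LIMSEQ_le_const[OF lim, of "\<bar>h\<bar>"] that by auto
  have f: "f \<in> mspace X \<rightarrow> mspace Y" and g: "g \<in> mspace Y \<rightarrow> mspace X"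
    using fg[of 0] by (auto simp: C_def topT)
  have "F x x' (f, g) = 0" if "x \<in> mspace X" "x' \<in> mspace X" for x x'
    using fg that by (intro null) (auto simp: C_def)
  then have isof: "mdist Y (f x) (f x') = mdist X x x'" if "x \<in> mspace X" "x' \<in> mspace X" for x x'
    using that by (intro powr_powr_inverse[OF p mdist_nonneg mdist_nonneg]) (simp add: F_def)
  have "G x y (f, g) = 0" if "x \<in> mspace X" "y \<in> mspace Y" for x y
    using fg that by (intro null) (auto simp: C_def)
  then have isog: "mdist X x (g y) = mdist Y (f x) y" if "x \<in> mspace X" "y \<in> mspace Y" for x y
    using that by (intro powr_powr_inverse[OF p mdist_nonneg mdist_nonneg]) (simp add: G_def)
  have zeroX: "mdist X u v = 0 \<longleftrightarrow> u = v" if "u \<in> mspace X" "v \<in> mspace X" for u v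
    using that by (rule Metric_space.zero[OF Metric_space_mspace_mdist])
  have zeroY: "mdist Y u v = 0 \<longleftrightarrow> u = v" if "u \<in> mspace Y" "v \<in> mspace Y" for u v
    using that by (rule Metric_space.zero[OF Metric_space_mspace_mdist])
  have "f (g y) = y" if "y \<in> mspace Y" for y
  proof -
    have gy: "g y \<in> mspace X" "f (g y) \<in> mspace Y"
      using that f g by blast+
    then show ?thesis
      using isog[OF gy(1) that] zeroX[OF gy(1) gy(1)] zeroY[OF gy(2) that] by simp
  qed
  then have "y \<in> f ` mspace X" if "y \<in> mspace Y" for y
    using that g by (intro rev_image_eqI[of "g y"]) auto
  moreover have "inj_on f (mspace X)"
  proof (rule inj_onI)
    fix u v assume "u \<in> mspace X" "v \<in> mspace X" "f u = f v"
    then show "u = v"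
      using isof[of u v] zeroX[of u v] zeroY[of "f u" "f v"] f by (simp add: Pi_iff)
  qed
  ultimately have "bij_betw f (mspace X) (mspace Y)"
    using f unfolding bij_betw_def by blast
  then show ?thesis
    using isof unfolding isometric_def by blast
qed


subsection \<open>The space of isometry classes\<close>

lemma isometry_classes_cases:
  assumes "A \<in> isometry_classes p"
  obtains X :: "real metric" where "X \<in> compact_p_metrics p" "A = {Y. isometric X Y}"
proof -
  obtain X :: "real metric" where A: "A = {(X, Y). X \<in> compact_p_metrics p \<and>
      Y \<in> compact_p_metrics p \<and> isometric X Y} `` {X}" and X: "X \<in> compact_p_metrics p"
    using assms unfolding isometry_classes_def by (rule quotientE)
  then have "A = {Y. isometric X Y}"
    using isometric_compact_p_metrics by blast
  then show ?thesis
    using that X by blast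
qed

lemma isometry_classes_memI:
  fixes X :: "real metric"
  assumes "X \<in> compact_p_metrics p"
  shows "{Y. isometric X Y} \<in> isometry_classes p"
proof -
  have "{Y. isometric X Y} = {(X, Y). X \<in> compact_p_metrics p \<and>
      Y \<in> compact_p_metrics p \<and> isometric X Y} `` {X}"
    using assms isometric_compact_p_metrics by blast
  also have "\<dots> \<in> isometry_classes p"
    unfolding isometry_classes_def by (rule quotientI[OF assms])
  finally show ?thesis .
qed

lemma GH_dist_cong_le:
  assumes p: "1 \<le> p"
    and U: "U \<in> compact_p_metrics p" "U' \<in> compact_p_metrics p" "isometric U U'"
    and V: "V \<in> compact_p_metrics p" "V' \<in> compact_p_metrics p" "isometric V V'"
  shows "GH_dist p U V \<le> GH_dist p U' V'"
proof -
  have "GH_dist p U V powr p \<le> GH_dist p U' V' powr p"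
    using GH_dist_triangle[OF p U(1,2) V(1)] GH_dist_triangle[OF p U(2) V(2,1)]
      GH_dist_eq_0[OF p U] GH_dist_eq_0[OF p V(2,1) isometric_sym[OF V(3)]] p by simp
  then have "(GH_dist p U V powr p) powr (1 / p) \<le> (GH_dist p U' V' powr p) powr (1 / p)"
    using p by (intro powr_mono2[of "1 / p"]) auto
  then show ?thesis
    by (simp only: powr_powr_cancel[OF p GH_dist_nonneg[OF p U(1) V(1)]]
        powr_powr_cancel[OF p GH_dist_nonneg[OF p U(2) V(2)]])
qed

lemma GH_dist_cong:
  assumes p: "1 \<le> p" and X: "X \<in> compact_p_metrics p" "isometric X X'"
    and Y: "Y \<in> compact_p_metrics p" "isometric Y Y'"
  shows "GH_dist p X Y = GH_dist p X' Y'"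
  using GH_dist_cong_le[OF p X(1) isometric_compact_p_metrics[OF X] X(2)
      Y(1) isometric_compact_p_metrics[OF Y] Y(2)]
    GH_dist_cong_le[OF p isometric_compact_p_metrics[OF X] X(1) isometric_sym[OF X(2)]
      isometric_compact_p_metrics[OF Y] Y(1) isometric_sym[OF Y(2)]]
  by linarith

lemma isometry_classes_mem:
  assumes "A \<in> isometry_classes p" "X \<in> A"
  shows "X \<in> compact_p_metrics p" "A = {Y. isometric X Y}"
proof -
  obtain X0 :: "real metric" where X0: "X0 \<in> compact_p_metrics p" "A = {Y. isometric X0 Y}"
    using assms(1) by (rule isometry_classes_cases)
  then have iso: "isometric X0 X"
    using assms(2) by simp
  show "X \<in> compact_p_metrics p"
    using isometric_compact_p_metrics[OF X0(1) iso] .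
  show "A = {Y. isometric X Y}"
    unfolding X0(2) using iso isometric_sym isometric_trans by blast
qed

theorem GH_class_dist_eq:
  assumes p: "1 \<le> p" and A: "A \<in> isometry_classes p" "X \<in> A"
    and B: "B \<in> isometry_classes p" "Y \<in> B"
  shows "GH_class_dist p A B = GH_dist p X Y"
proof -
  have "(SOME X. X \<in> A) \<in> A" "(SOME Y. Y \<in> B) \<in> B"
    using A(2) B(2) by (auto intro: someI)
  then have iso: "isometric X (SOME X. X \<in> A)" "isometric Y (SOME Y. Y \<in> B)"
    using isometry_classes_mem(2)[OF A] isometry_classes_mem(2)[OF B] by blast+
  show ?thesis
    using GH_dist_cong[OF p isometry_classes_mem(1)[OF A] iso(1) isometry_classes_mem(1)[OF B] iso(2)]
      A(1) B(1) by (simp add: GH_class_dist_def)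
qed

lemma isometry_classes_rep:
  assumes "A \<in> isometry_classes p"
  obtains X :: "real metric" where "X \<in> compact_p_metrics p" "X \<in> A"
  using assms by (rule isometry_classes_cases) (rule that, assumption, simp add: isometric_refl)

lemma GH_class_dist_triangle:
  assumes p: "1 \<le> p"
    and ABC: "A \<in> isometry_classes p" "B \<in> isometry_classes p" "C \<in> isometry_classes p"
  shows "GH_class_dist p A C powr p \<le> GH_class_dist p A B powr p + GH_class_dist p B C powr p"
proof -
  obtain X where X: "X \<in> compact_p_metrics p" "X \<in> A"
    using isometry_classes_rep[OF ABC(1)] .
  obtain Y where Y: "Y \<in> compact_p_metrics p" "Y \<in> B"
    using isometry_classes_rep[OF ABC(2)] .
  obtain Z where Z: "Z \<in> compact_p_metrics p" "Z \<in> C"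
    using isometry_classes_rep[OF ABC(3)] .
  show ?thesis
    using GH_dist_triangle[OF p X(1) Y(1) Z(1)]
    by (simp add: GH_class_dist_eq[OF p ABC(1) X(2) ABC(3) Z(2)]
        GH_class_dist_eq[OF p ABC(1) X(2) ABC(2) Y(2)]
        GH_class_dist_eq[OF p ABC(2) Y(2) ABC(3) Z(2)])
qed

text \<open>A \<open>p\<close>-metric satisfies the \<open>q\<close>-triangle inequality for \<open>q \<le> p\<close>.\<close>
lemma p_triangle_mono:
  fixes a b c :: real
  assumes q: "1 \<le> q" "q \<le> p" and nonneg: "0 \<le> a" "0 \<le> b" "0 \<le> c"
    and le: "c powr p \<le> a powr p + b powr p"
  shows "c powr q \<le> a powr q + b powr q"
proof (cases "a = 0 \<and> b = 0")
  case True
  then show ?thesis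
    using le q by (simp add: powr_def split: if_splits)
next
  case False
  define s where "s = (a powr q + b powr q) powr (1 / q)"
  have sq: "s powr q = a powr q + b powr q"
    using q by (simp add: s_def powr_powr)
  have pos: "0 < a powr q + b powr q"
    using False nonneg by (smt (verit) powr_gt_zero powr_ge_zero)
  then have s: "s > 0"
    by (simp add: s_def)
  have le_s: "t \<le> s" if "t powr q \<le> s powr q" "0 \<le> t" for t
    using that s q powr_less_mono2[of q s t] by fastforce
  have quot: "(t / s) powr p \<le> (t / s) powr q" if "0 \<le> t" "t powr q \<le> s powr q" for t
    using le_s[OF that(2,1)] that s q by (cases "t = 0") (auto intro!: powr_mono')
  have "(c / s) powr p \<le> (a / s) powr p + (b / s) powr p"
    using le s nonneg by (simp add: powr_divide add_divide_distrib[symmetric] divide_right_mono)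
  also have "\<dots> \<le> (a / s) powr q + (b / s) powr q"
    using nonneg by (intro add_mono quot) (auto simp: sq)
  also have "\<dots> = 1"
    using s nonneg sq pos by (simp add: powr_divide add_divide_distrib[symmetric])
  finally have "c / s \<le> 1"
    using powr_less_mono2[of p 1 "c / s"] q by fastforce
  then have "c \<le> s"
    using s by (simp add: field_simps)
  then have "c powr q \<le> s powr q"
    using nonneg q by (intro powr_mono2) auto
  then show ?thesis
    by (simp add: sq)
qed

lemma GH_class_dist_nonneg:
  assumes p: "1 \<le> p"
  shows "0 \<le> GH_class_dist p A B"
proof (cases "A \<in> isometry_classes p \<and> B \<in> isometry_classes p")
  case True
  then have A: "A \<in> isometry_classes p" and B: "B \<in> isometry_classes p"
    by blast+
  obtain X where X: "X \<in> compact_p_metrics p" "X \<in> A"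
    using isometry_classes_rep[OF A] .
  obtain Y where Y: "Y \<in> compact_p_metrics p" "Y \<in> B"
    using isometry_classes_rep[OF B] .
  show ?thesis
    unfolding GH_class_dist_eq[OF p A X(2) B Y(2)] by (rule GH_dist_nonneg[OF p X(1) Y(1)])
qed (auto simp: GH_class_dist_def)

lemma GH_class_dist_commute:
  assumes p: "1 \<le> p"
  shows "GH_class_dist p A B = GH_class_dist p B A"
proof (cases "A \<in> isometry_classes p \<and> B \<in> isometry_classes p")
  case True
  then have A: "A \<in> isometry_classes p" and B: "B \<in> isometry_classes p"
    by blast+
  obtain X where X: "X \<in> compact_p_metrics p" "X \<in> A"
    using isometry_classes_rep[OF A] .
  obtain Y where Y: "Y \<in> compact_p_metrics p" "Y \<in> B"
    using isometry_classes_rep[OF B] .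
  show ?thesis
    unfolding GH_class_dist_eq[OF p A X(2) B Y(2)] GH_class_dist_eq[OF p B Y(2) A X(2)]
    by (rule GH_dist_commute[OF p X(1) Y(1)])
qed (auto simp: GH_class_dist_def)

theorem Metric_space_GH:
  assumes p: "1 \<le> p"
  shows "Metric_space (isometry_classes p) (GH_class_dist p)"
proof
  show "0 \<le> GH_class_dist p A B" "GH_class_dist p A B = GH_class_dist p B A" for A B
    by (rule GH_class_dist_nonneg[OF p], rule GH_class_dist_commute[OF p])
  show "GH_class_dist p A B = 0 \<longleftrightarrow> A = B"
    if A: "A \<in> isometry_classes p" and B: "B \<in> isometry_classes p" for A B
  proof -
    obtain X where X: "X \<in> compact_p_metrics p" "X \<in> A"
      using isometry_classes_rep[OF A] .
    obtain Y where Y: "Y \<in> compact_p_metrics p" "Y \<in> B"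
      using isometry_classes_rep[OF B] .
    have "GH_class_dist p A B = 0 \<longleftrightarrow> isometric X Y"
      using GH_class_dist_eq[OF p A X(2) B Y(2)] GH_dist_eq_0[OF p X(1) Y(1)]
        GH_dist_eq_0_imp_isometric[OF p X(1) Y(1)] by auto
    also have "\<dots> \<longleftrightarrow> A = B"
    proof
      assume "isometric X Y"
      then have "Y \<in> A"
        using isometry_classes_mem(2)[OF A X(2)] by simp
      then show "A = B"
        using isometry_classes_mem(2)[OF A] isometry_classes_mem(2)[OF B Y(2)] by blast
    next
      assume "A = B"
      then show "isometric X Y"
        using isometry_classes_mem(2)[OF A X(2)] Y(2) by blast
    qed
    finally show ?thesis .
  qed
  show "GH_class_dist p A C \<le> GH_class_dist p A B + GH_class_dist p B C"
    if ABC: "A \<in> isometry_classes p" "B \<in> isometry_classes p" "C \<in> isometry_classes p" for A B C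
  proof -
    have "GH_class_dist p A C powr 1 \<le> GH_class_dist p A B powr 1 + GH_class_dist p B C powr 1"
      by (rule p_triangle_mono[OF order_refl p _ _ _ GH_class_dist_triangle[OF p ABC]])
        (rule GH_class_dist_nonneg[OF p])+
    then show ?thesis
      by (simp only: powr_one GH_class_dist_nonneg[OF p])
  qed
qed

lemma mspace_GH_space: "1 \<le> p \<Longrightarrow> mspace (GH_space p) = isometry_classes p"
  and mdist_GH_space: "1 \<le> p \<Longrightarrow> mdist (GH_space p) = GH_class_dist p"
  unfolding GH_space_def
  by (simp_all only: Metric_space.mspace_metric[OF Metric_space_GH]
      Metric_space.mdist_metric[OF Metric_space_GH])

lemma isometry_classes_nonempty: "isometry_classes p \<noteq> {}"
proof -
  let ?d = "\<lambda>_ _. 0 :: real"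
  have M: "Metric_space {0 :: real} ?d"
    by (simp add: Metric_space_def)
  have "compact_space (mtopology_of (metric ({0 :: real}, ?d)))"
    unfolding compact_space_def topspace_mtopology_of Metric_space.mspace_metric[OF M]
    by (rule finite_imp_compactin) (simp_all add: Metric_space.mspace_metric[OF M])
  then have "metric ({0 :: real}, ?d) \<in> compact_p_metrics p"
    by (simp add: compact_p_metrics_def p_metric_space_def Metric_space.mspace_metric[OF M]
        Metric_space.mdist_metric[OF M])
  then show ?thesis
    by (rule ex_in_conv[THEN iffD1, OF exI, OF isometry_classes_memI])
qed

lemma p_metric_space_mono:
  assumes "p_metric_space p X" "1 \<le> q" "q \<le> p"
  shows "p_metric_space q X"
  unfolding p_metric_space_def
proof (intro conjI ballI)
  show "mspace X \<noteq> {}"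
    using assms(1) by (simp add: p_metric_space_def)
  fix x x' x''
  assume "x \<in> mspace X" "x' \<in> mspace X" "x'' \<in> mspace X"
  then have "mdist X x x'' powr p \<le> mdist X x x' powr p + mdist X x' x'' powr p"
    using assms(1) unfolding p_metric_space_def by blast
  then show "mdist X x x'' powr q \<le> mdist X x x' powr q + mdist X x' x'' powr q"
    by (intro p_triangle_mono[OF assms(2,3)] mdist_nonneg)
qed

theorem p_metric_space_GH_space:
  assumes "1 \<le> q" "q \<le> p"
  shows "p_metric_space q (GH_space p)"
proof (rule p_metric_space_mono[OF _ assms])
  have p: "1 \<le> p"
    using assms by linarith
  show "p_metric_space p (GH_space p)"
    unfolding p_metric_space_def mspace_GH_space[OF p] mdist_GH_space[OF p]
    using isometry_classes_nonempty GH_class_dist_triangle[OF p] by blast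
qed

end

theory Submission
  imports Defs
begin

text \<open>
  Two compact \<open>p\<close>-metric spaces \<open>X\<close>, \<open>Y\<close> admit an optimal correspondence \<open>R\<close> that is closed in
  \<open>X \<times> Y\<close>, hence compact.  The \<open>p\<close>-th powers of the two distances pull back to \<open>R\<close>, and
  \<open>d\<^sub>t\<^sup>p = (1 - t) d\<^sub>X\<^sup>p + t d\<^sub>Y\<^sup>p\<close> is a compact \<open>p\<close>-metric on \<open>R\<close> for \<open>0 < t < 1\<close>.  The identity
  correspondence bounds the distance from time \<open>s\<close> to time \<open>t\<close> by \<open>\<bar>s - t\<bar>\<^sup>1\<^sup>/\<^sup>p d(X, Y)\<close>, and the
  \<open>p\<close>-triangle inequality along \<open>0 \<le> s \<le> t \<le> 1\<close> forces equality.  Conversely, the midpoint of a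
  \<open>q\<close>-geodesic of length \<open>D > 0\<close> would give \<open>D\<^sup>p \<le> 2 (D / 2\<^sup>1\<^sup>/\<^sup>q)\<^sup>p < D\<^sup>p\<close> for \<open>q < p\<close>.
\<close>

section \<open>Continuity of powers of distances\<close>

lemma continuous_map_powr_real:
  assumes "0 < p" "continuous_map T euclideanreal h" "\<And>z. z \<in> topspace T \<Longrightarrow> 0 \<le> h z"
  shows "continuous_map T euclideanreal (\<lambda>z. h z powr p)"
proof -
  \<comment> \<open>Composing with \<open>max 0\<close> gives a function continuous on the whole
    line that agrees with the power on the nonnegative values of \<open>h\<close>.\<close>
  have "continuous_on UNIV (\<lambda>t :: real. max 0 t powr p)"
    using assms(1) by (intro continuous_on_powr' continuous_on_max
        continuous_on_const continuous_on_id) auto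
  then have "continuous_map T euclideanreal ((\<lambda>t. max 0 t powr p) \<circ> h)"
    using assms(2) by (intro continuous_map_compose[of _ euclideanreal]) simp_all
  then show ?thesis
    by (rule continuous_map_eq) (simp add: assms(3))
qed

lemma continuous_map_mdist_powr:
  assumes "0 < p" "continuous_map T (mtopology_of W) u" "continuous_map T (mtopology_of W) v"
  shows "continuous_map T euclideanreal (\<lambda>z. mdist W (u z) (v z) powr p)"
  by (intro continuous_map_powr_real continuous_map_mdist assms mdist_nonneg)

lemma closedin_abs_le:
  fixes e :: real
  assumes "continuous_map T euclideanreal h"
  shows "closedin T {z \<in> topspace T. \<bar>h z\<bar> \<le> e}"
proof -
  have "{z \<in> topspace T. \<bar>h z\<bar> \<le> e} = {z \<in> topspace T. h z \<in> {-e..e}}"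
    by auto
  then show ?thesis
    using closedin_continuous_map_preimage[OF assms, of "{-e..e}"] by simp
qed

section \<open>Existence of closed optimal correspondences\<close>

text \<open>
  A choice of a partner for every point of \<open>X\<close> and of \<open>Y\<close> is a point of a compact product space;
  the almost optimal choices form a decreasing sequence of nonempty closed sets.
\<close>
lemma optimal_correspondence:
  assumes p: "1 \<le> p" and X: "X \<in> compact_p_metrics p" and Y: "Y \<in> compact_p_metrics p"
  obtains R where "correspondence R (mspace X) (mspace Y)"
    "\<And>x y x' y'. (x, y) \<in> R \<Longrightarrow> (x', y') \<in> R \<Longrightarrow>
        \<bar>mdist X x x' powr p - mdist Y y y' powr p\<bar> \<le> 2 * GH_dist p X Y powr p"
proof -
  let ?r = "GH_dist p X Y"
  have p0: "0 < p"
    using p by linarith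
  define T where "T = prod_topology (product_topology (\<lambda>_. mtopology_of Y) (mspace X))
                                    (product_topology (\<lambda>_. mtopology_of X) (mspace Y))"
  have T: "compact_space T"
    using X Y by (simp add: T_def compact_p_metrics_def compact_space_prod_topology
        compact_space_product_topology)
  have topT: "topspace T = (mspace X \<rightarrow>\<^sub>E mspace Y) \<times> (mspace Y \<rightarrow>\<^sub>E mspace X)"
    by (simp add: T_def)
  \<comment> \<open>One index per point of \<open>X\<close> and per point of \<open>Y\<close>;
    \<open>(u i z, v i z)\<close> is the pair that the choice \<open>z\<close> attaches to index
    \<open>i\<close>. Indices \<open>Inl x\<close> cover \<open>X\<close>, indices
    \<open>Inr y\<close> cover \<open>Y\<close>, and the single function \<open>F\<close> treats all
    combinations of the two kinds at once.\<close>
  define I where "I = mspace X <+> mspace Y"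
  define u where "u = (\<lambda>i (z :: ('a \<Rightarrow> 'b) \<times> ('b \<Rightarrow> 'a)). case i of Inl x \<Rightarrow> x | Inr y \<Rightarrow> snd z y)"
  define v where "v = (\<lambda>i (z :: ('a \<Rightarrow> 'b) \<times> ('b \<Rightarrow> 'a)). case i of Inl x \<Rightarrow> fst z x | Inr y \<Rightarrow> y)"
  have cu: "continuous_map T (mtopology_of X) (u i)" if i: "i \<in> I" for i
  proof (cases i)
    case (Inl x)
    with i have "x \<in> mspace X" by (auto simp: I_def)
    then show ?thesis by (simp add: u_def Inl)
  next
    case (Inr y)
    with i have "y \<in> mspace Y" by (auto simp: I_def)
    from continuous_map_compose[OF continuous_map_snd continuous_map_product_projection[OF this]]
    show ?thesis unfolding T_def u_def Inr o_def sum.case by fast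
  qed
  have cv: "continuous_map T (mtopology_of Y) (v i)" if i: "i \<in> I" for i
  proof (cases i)
    case (Inl x)
    with i have "x \<in> mspace X" by (auto simp: I_def)
    from continuous_map_compose[OF continuous_map_fst continuous_map_product_projection[OF this]]
    show ?thesis unfolding T_def v_def Inl o_def sum.case by fast
  next
    case (Inr y)
    with i have "y \<in> mspace Y" by (auto simp: I_def)
    then show ?thesis by (simp add: v_def Inr)
  qed
  define F where "F = (\<lambda>i j z. mdist X (u i z) (u j z) powr p - mdist Y (v i z) (v j z) powr p)"
  have cF: "continuous_map T euclideanreal (F i j)" if "i \<in> I" "j \<in> I" for i j
    unfolding F_def by (intro continuous_map_diff continuous_map_mdist_powr p0 cu cv that)
  \<comment> \<open>\<open>GH_dist_less\<close> asks for a strict inequality, hence the positive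
    slack; it tends to \<open>0\<close>, so a choice lying in every \<open>C n\<close> attains the
    infimum itself.\<close>
  define e where "e = (\<lambda>n. 2 * (?r + inverse (real (Suc n))) powr p)"
  define C where "C = (\<lambda>n. {z \<in> topspace T. \<forall>i\<in>I. \<forall>j\<in>I. \<bar>F i j z\<bar> \<le> e n})"
  \<comment> \<open>An intersection over an empty index set would be the whole type rather than
    \<open>topspace T\<close>.\<close>
  have "I \<noteq> {}"
    using compact_p_metrics_nonempty[OF X] by (auto simp: I_def)
  then have "C n = (\<Inter>i\<in>I. \<Inter>j\<in>I. {z \<in> topspace T. \<bar>F i j z\<bar> \<le> e n})" for n
    unfolding C_def by blast
  with \<open>I \<noteq> {}\<close> have "closedin T (C n)" for n
    by (auto intro!: closedin_INT closedin_abs_le cF)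
  moreover have "C n \<noteq> {}" for n
  proof -
    have lt: "?r < ?r + inverse (Suc n)"
      by simp
    obtain R where R: "correspondence R (mspace X) (mspace Y)"
      "\<And>x y x' y'. (x, y) \<in> R \<Longrightarrow> (x', y') \<in> R \<Longrightarrow>
          \<bar>mdist X x x' powr p - mdist Y y y' powr p\<bar> \<le> e n"
      using GH_dist_less[OF p X Y lt] unfolding e_def by blast
    have sub: "R \<subseteq> mspace X \<times> mspace Y"
      and "\<forall>x\<in>mspace X. \<exists>y. (x, y) \<in> R" "\<forall>y\<in>mspace Y. \<exists>x. (x, y) \<in> R"
      using R(1) unfolding correspondence_iff by blast+
    then obtain f g where f: "\<And>x. x \<in> mspace X \<Longrightarrow> (x, f x) \<in> R"
      and g: "\<And>y. y \<in> mspace Y \<Longrightarrow> (g y, y) \<in> R"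
      by metis
    let ?z = "(restrict f (mspace X), restrict g (mspace Y))"
    have "(u i ?z, v i ?z) \<in> R" if "i \<in> I" for i
      using that f g by (auto simp: I_def u_def v_def)
    moreover have "?z \<in> topspace T"
      using f g sub unfolding topT by auto
    ultimately have "?z \<in> C n"
      unfolding C_def F_def using R(2) by blast
    then show ?thesis
      by blast
  qed
  moreover have "decseq C"
  proof (rule decseq_SucI)
    fix n
    have "e (Suc n) \<le> e n"
      unfolding e_def using p GH_dist_nonneg[OF p X Y]
      by (intro mult_left_mono powr_mono2 le_imp_inverse_le add_left_mono) auto
    then show "C (Suc n) \<subseteq> C n"
      unfolding C_def by (blast intro: order_trans)
  qed
  ultimately have "(\<Inter>n. C n) \<noteq> {}"
    by (intro compact_space_imp_nest[OF T])
  then obtain z where z: "\<And>n. z \<in> C n"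
    by fast
  have "e \<longlonglongrightarrow> 2 * (?r + 0) powr p"
    unfolding e_def using p GH_dist_nonneg[OF p X Y]
    by (intro tendsto_intros tendsto_powr' LIMSEQ_inverse_real_of_nat) auto
  then have le: "\<bar>F i j z\<bar> \<le> 2 * ?r powr p" if "i \<in> I" "j \<in> I" for i j
    using LIMSEQ_le_const[of e "2 * ?r powr p" "\<bar>F i j z\<bar>"] z that by (auto simp: C_def)
  show ?thesis
  proof (rule that[of "(\<lambda>i. (u i z, v i z)) ` I"])
    have "z \<in> topspace T"
      using z[of 0] by (simp add: C_def)
    then have "u i z \<in> mspace X" "v i z \<in> mspace Y" if "i \<in> I" for i
      using that by (auto simp: topT I_def u_def v_def)
    moreover have "x = u (Inl x) z" "y = v (Inr y) z" "x \<in> mspace X \<Longrightarrow> Inl x \<in> I"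
      "y \<in> mspace Y \<Longrightarrow> Inr y \<in> I" for x y
      by (auto simp: u_def v_def I_def)
    ultimately show "correspondence ((\<lambda>i. (u i z, v i z)) ` I) (mspace X) (mspace Y)"
      unfolding correspondence_iff by blast
  qed (use le in \<open>auto simp: F_def\<close>)
qed

text \<open>For continuous distances the distortion bound is a closed condition, so it passes to the
  closure, which still projects onto both factors. Closedness in a compact product is what will make
  the interpolated spaces compact.\<close>

lemma closed_optimal_correspondence:
  assumes p: "1 \<le> p" and X: "X \<in> compact_p_metrics p" and Y: "Y \<in> compact_p_metrics p"
  obtains R where "correspondence R (mspace X) (mspace Y)"
    "closedin (prod_topology (mtopology_of X) (mtopology_of Y)) R"
    "\<And>x y x' y'. (x, y) \<in> R \<Longrightarrow> (x', y') \<in> R \<Longrightarrow>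
        \<bar>mdist X x x' powr p - mdist Y y y' powr p\<bar> \<le> 2 * GH_dist p X Y powr p"
proof -
  let ?T = "prod_topology (mtopology_of X) (mtopology_of Y)"
  let ?F = "\<lambda>z w. mdist X (fst z) (fst w) powr p - mdist Y (snd z) (snd w) powr p"
  let ?e = "2 * GH_dist p X Y powr p"
  obtain R where R: "correspondence R (mspace X) (mspace Y)"
    and dis: "\<And>x y x' y'. (x, y) \<in> R \<Longrightarrow> (x', y') \<in> R \<Longrightarrow>
        \<bar>mdist X x x' powr p - mdist Y y y' powr p\<bar> \<le> ?e"
    using optimal_correspondence[OF p X Y] by blast
  have le: "\<bar>?F z w\<bar> \<le> ?e" if "z \<in> R" "w \<in> R" for z w
    using that dis[of "fst z" "snd z" "fst w" "snd w"] by simp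
  have RT: "R \<subseteq> topspace ?T"
    using R by (simp add: correspondence_def)
  have "closedin ?T {w \<in> topspace ?T. \<bar>?F z w\<bar> \<le> ?e}" if "z \<in> topspace ?T" for z
    using that p by (intro closedin_abs_le continuous_map_diff continuous_map_mdist_powr
        continuous_map_fst continuous_map_snd) auto
  then have ext: "\<bar>?F z w\<bar> \<le> ?e"
    if "z \<in> topspace ?T" "w \<in> ?T closure_of R" "\<And>w. w \<in> R \<Longrightarrow> \<bar>?F z w\<bar> \<le> ?e" for z w
    using that RT closure_of_minimal[of R "{w \<in> topspace ?T. \<bar>?F z w\<bar> \<le> ?e}" ?T] by blast
  have sym: "\<bar>?F z w\<bar> = \<bar>?F w z\<bar>" for z w
    by (simp add: mdist_commute)
  have "\<bar>?F z w\<bar> \<le> ?e" if "z \<in> R" "w \<in> ?T closure_of R" for z w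
    by (rule ext[OF subsetD[OF RT that(1)] that(2) le[OF that(1)]])
  \<comment> \<open>The closure is taken in one argument at a time: the bound is known for
    \<open>z\<close> in \<open>R\<close> and \<open>w\<close> in the closure, and symmetry of
    \<open>?F\<close> lets \<open>ext\<close> act on the other argument.\<close>
  then have cl: "\<bar>?F z w\<bar> \<le> ?e" if "z \<in> ?T closure_of R" "w \<in> ?T closure_of R" for z w
    using ext[OF subsetD[OF closure_of_subset_topspace that(1)] that(2)] that(1) sym by metis
  have "correspondence (?T closure_of R) (mspace X) (mspace Y)"
    using R closure_of_subset[OF RT] closure_of_subset_topspace[of ?T R]
    unfolding correspondence_iff by fastforce
  then show ?thesis
    using cl by (intro that[of "?T closure_of R"]) fastforce+
qed

section \<open>Interpolation between two compact \<open>p\<close>-metric spaces\<close>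

text \<open>The \<open>p\<close>-triangle inequality is linear in \<open>p\<close>-th powers of
  distances, so it survives convex combinations of them.\<close>

lemma interpolated_metric:
  fixes X :: "'a metric" and Y :: "'b metric"
  assumes p: "1 \<le> p" and X: "X \<in> compact_p_metrics p" and Y: "Y \<in> compact_p_metrics p"
    and R: "correspondence R (mspace X) (mspace Y)"
    and closed: "closedin (prod_topology (mtopology_of X) (mtopology_of Y)) R"
    and t: "0 < t" "t < 1"
  obtains W where "W \<in> compact_p_metrics p" "mspace W = R"
    "\<And>z w. z \<in> R \<Longrightarrow> w \<in> R \<Longrightarrow> mdist W z w powr p =
        (1 - t) * mdist X (fst z) (fst w) powr p + t * mdist Y (snd z) (snd w) powr p"
proof -
  let ?T = "prod_topology (mtopology_of X) (mtopology_of Y)"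
  let ?S = "subtopology ?T R"
  define D where "D = (\<lambda>z w. (1 - t) * mdist X (fst z) (fst w) powr p
      + t * mdist Y (snd z) (snd w) powr p)"
  define d where "d = (\<lambda>z w. D z w powr (1 / p))"
  have p0: "0 < p"
    using p by linarith
  have D0: "0 \<le> D z w" for z w
    using t by (simp add: D_def)
  have dp: "d z w powr p = D z w" for z w
    using p D0 by (simp add: d_def powr_powr)
  have mem: "fst z \<in> mspace X" "snd z \<in> mspace Y" if "z \<in> R" for z
    using that R by (auto simp: correspondence_def)
  have D_tri: "D z w \<le> D z v + D v w" if "z \<in> R" "v \<in> R" "w \<in> R" for z v w
  proof -
    have "mdist X (fst z) (fst w) powr p
        \<le> mdist X (fst z) (fst v) powr p + mdist X (fst v) (fst w) powr p"
      "mdist Y (snd z) (snd w) powr p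
        \<le> mdist Y (snd z) (snd v) powr p + mdist Y (snd v) (snd w) powr p"
      using X Y mem that unfolding compact_p_metrics_def p_metric_space_def by blast+
    then have "D z w \<le> (1 - t) * (mdist X (fst z) (fst v) powr p + mdist X (fst v) (fst w) powr p)
        + t * (mdist Y (snd z) (snd v) powr p + mdist Y (snd v) (snd w) powr p)"
      unfolding D_def using t by (intro add_mono mult_left_mono) auto
    then show ?thesis
      by (simp add: D_def algebra_simps)
  qed
  have zeroX: "mdist X x x' = 0 \<longleftrightarrow> x = x'" if "x \<in> mspace X" "x' \<in> mspace X" for x x'
    using that by (rule Metric_space.zero[OF Metric_space_mspace_mdist])
  have zeroY: "mdist Y y y' = 0 \<longleftrightarrow> y = y'" if "y \<in> mspace Y" "y' \<in> mspace Y" for y y'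
    using that by (rule Metric_space.zero[OF Metric_space_mspace_mdist])
  interpret Metric_space R d
  proof
    show "0 \<le> d z w" "d z w = d w z" for z w
      by (simp_all add: d_def D_def mdist_commute)
    show "d z w = 0 \<longleftrightarrow> z = w" if zw: "z \<in> R" "w \<in> R" for z w
    proof -
      have "d z w = 0 \<longleftrightarrow> D z w = 0"
        by (simp add: d_def)
      \<comment> \<open>Both weights are strictly positive, so the sum vanishes only if both
        distances do; at \<open>t = 0\<close> or \<open>t = 1\<close> one coordinate would be
        lost.\<close>
      also have "\<dots> \<longleftrightarrow> mdist X (fst z) (fst w) = 0 \<and> mdist Y (snd z) (snd w) = 0"
        unfolding D_def using t by (subst add_nonneg_eq_0_iff) auto
      also have "\<dots> \<longleftrightarrow> z = w"
        using mem zw by (simp add: zeroX zeroY prod_eq_iff)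
      finally show ?thesis .
    qed
    show "d z w \<le> d z v + d v w" if "z \<in> R" "v \<in> R" "w \<in> R" for z v w
      using p_triangle_mono[of 1 p "d z v" "d v w" "d z w"] p D_tri[OF that] dp
      by (simp add: d_def)
  qed
  have "compact_space ?T"
    using X Y by (simp add: compact_p_metrics_def compact_space_prod_topology)
  then have S: "compact_space ?S"
    using closed closedin_compact_space compact_space_subtopology by blast
  have topS: "topspace ?S = R"
    using closedin_subset[OF closed] by auto
  \<comment> \<open>The function \<open>d z\<close> is continuous for the product topology, so
    \<open>d\<close>-balls are open there; the topology of \<open>d\<close> is then coarser than a
    compact one, hence compact.\<close>
  have "continuous_map ?S mtopology id"
    unfolding continuous_map_to_metric topS
  proof (intro ballI allI impI)
    fix z :: "'a \<times> 'b" and e :: real assume z: "z \<in> R" and e: "0 < e"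
    have "continuous_map ?S euclideanreal (\<lambda>w. d z w)"
      unfolding d_def D_def using mem[OF z] p0 t
      by (intro continuous_map_powr_real continuous_map_add continuous_map_real_mult_left
          continuous_map_mdist_powr
          continuous_map_from_subtopology[OF continuous_map_fst]
          continuous_map_from_subtopology[OF continuous_map_snd]) auto
    then have "openin ?S {w \<in> topspace ?S. d z w \<in> {..<e}}"
      by (rule openin_continuous_map_preimage) simp
    then show "\<exists>U. openin ?S U \<and> z \<in> U \<and> (\<forall>w\<in>U. id w \<in> mball (id z) e)"
      using z e unfolding topS by (intro exI[of _ "{w \<in> R. d z w \<in> {..<e}}"]) auto
  qed
  from image_compactin[OF S[unfolded compact_space_def] this]
  have "compactin mtopology R"
    unfolding topS by simp
  then have "compact_space (mtopology_of (metric (R, d)))"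
    by (simp add: mtopology_of_def compact_space_def)
  moreover have "R \<noteq> {}"
    using correspondence_nonempty[OF R compact_p_metrics_nonempty[OF X]] .
  ultimately have "metric (R, d) \<in> compact_p_metrics p"
    using D_tri by (simp add: compact_p_metrics_def p_metric_space_def dp)
  then show ?thesis
    using that[of "metric (R, d)"] by (simp add: dp D_def)
qed

section \<open>Construction of \<open>p\<close>-geodesics\<close>

lemma GH_space_p_geodesic:
  assumes p: "1 \<le> p"
  shows "q_geodesic_space p (GH_space p)"
  unfolding q_geodesic_space_def mspace_GH_space[OF p]
proof (intro ballI)
  fix A B assume A: "A \<in> isometry_classes p" and B: "B \<in> isometry_classes p"
  obtain X where X: "X \<in> compact_p_metrics p" "X \<in> A"
    using isometry_classes_rep[OF A] .
  obtain Y where Y: "Y \<in> compact_p_metrics p" "Y \<in> B"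
    using isometry_classes_rep[OF B] .
  let ?r = "GH_dist p X Y"
  obtain R where R: "correspondence R (mspace X) (mspace Y)"
    and closed: "closedin (prod_topology (mtopology_of X) (mtopology_of Y)) R"
    and dis: "\<And>x y x' y'. (x, y) \<in> R \<Longrightarrow> (x', y') \<in> R \<Longrightarrow>
        \<bar>mdist X x x' powr p - mdist Y y y' powr p\<bar> \<le> 2 * ?r powr p"
    using closed_optimal_correspondence[OF p X(1) Y(1)] by blast
  define D where "D = (\<lambda>t z w. (1 - t) * mdist X (fst z) (fst w) powr p
      + t * mdist Y (snd z) (snd w) powr p)"
  text \<open>At the ends \<open>D\<close> is only a pseudometric, so \<open>R\<close> must be mapped onto \<open>W\<close>, not identified with it.\<close>
  define good where "good = (\<lambda>t (W :: real metric) \<pi>. W \<in> compact_p_metrics p \<and> \<pi> ` R = mspace W \<and>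
      (\<forall>z\<in>R. \<forall>w\<in>R. mdist W (\<pi> z) (\<pi> w) powr p = D t z w) \<and>
      (t = 0 \<longrightarrow> W = X) \<and> (t = 1 \<longrightarrow> W = Y))"
  have "\<exists>W \<pi>. good t W \<pi>" if "t \<in> {0..1}" for t
  proof -
    have "t = 0 \<or> t = 1 \<or> 0 < t \<and> t < 1"
      using that by auto
    then consider "t = 0" | "t = 1" | "0 < t" "t < 1"
      by blast
    then show ?thesis
    proof cases
      case 1
      then show ?thesis
        using X R by (intro exI[of _ X] exI[of _ fst]) (auto simp: good_def D_def correspondence_def)
    next
      case 2
      then show ?thesis
        using Y R by (intro exI[of _ Y] exI[of _ snd]) (auto simp: good_def D_def correspondence_def)
    next
      case 3
      obtain V where V: "V \<in> compact_p_metrics p" "mspace V = R"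
        "\<And>z w. z \<in> R \<Longrightarrow> w \<in> R \<Longrightarrow> mdist V z w powr p = D t z w"
        using interpolated_metric[OF p X(1) Y(1) R closed 3] unfolding D_def by blast
      \<comment> \<open>The points of \<open>V\<close> are pairs, whereas isometry classes consist
        of metrics on real numbers.\<close>
      obtain W :: "real metric" where W: "W \<in> compact_p_metrics p" "isometric V W"
        using compact_p_metrics_real_copy[OF V(1)] .
      then obtain f where "bij_betw f (mspace V) (mspace W)"
        "\<And>z w. z \<in> mspace V \<Longrightarrow> w \<in> mspace V \<Longrightarrow> mdist W (f z) (f w) = mdist V z w"
        unfolding isometric_def by blast
      then show ?thesis
        using 3 V W(1) by (intro exI[of _ W] exI[of _ f]) (auto simp: good_def bij_betw_def)
    qed
  qed
  then obtain W \<pi> where good: "\<And>t. t \<in> {0..1} \<Longrightarrow> good t (W t) (\<pi> t)"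
    by metis
  then have W: "\<And>t. t \<in> {0..1} \<Longrightarrow> W t \<in> compact_p_metrics p"
    and \<pi>: "\<And>t. t \<in> {0..1} \<Longrightarrow> \<pi> t ` R = mspace (W t)"
    and dW: "\<And>t z w. t \<in> {0..1} \<Longrightarrow> z \<in> R \<Longrightarrow> w \<in> R \<Longrightarrow>
      mdist (W t) (\<pi> t z) (\<pi> t w) powr p = D t z w"
    unfolding good_def by blast+
  have W0: "W 0 = X" and W1: "W 1 = Y"
    using good[of 0] good[of 1] unfolding good_def by simp_all
  let ?G = "\<lambda>s t. GH_dist p (W s) (W t)"
  have upper: "?G s t powr p \<le> \<bar>s - t\<bar> * ?r powr p" if st: "s \<in> {0..1}" "t \<in> {0..1}" for s t
  proof -
    let ?c = "\<bar>s - t\<bar> powr (1 / p) * ?r"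
    have c: "?c powr p = \<bar>s - t\<bar> * ?r powr p"
      using p GH_dist_nonneg[OF p X(1) Y(1)] by (simp add: powr_mult powr_powr)
    have "?G s t \<le> ?c"
    proof (rule GH_dist_le[OF p W[OF st(1)] W[OF st(2)]])
      show "correspondence ((\<lambda>z. (\<pi> s z, \<pi> t z)) ` R) (mspace (W s)) (mspace (W t))"
        using \<pi>[OF st(1)] \<pi>[OF st(2)] unfolding correspondence_def image_image by auto
      show "0 \<le> ?c"
        using GH_dist_nonneg[OF p X(1) Y(1)] by simp
      fix a b a' b'
      assume "(a, b) \<in> (\<lambda>z. (\<pi> s z, \<pi> t z)) ` R" "(a', b') \<in> (\<lambda>z. (\<pi> s z, \<pi> t z)) ` R"
      then obtain z w where zw: "z \<in> R" "w \<in> R" "a = \<pi> s z" "b = \<pi> t z" "a' = \<pi> s w" "b' = \<pi> t w"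
        by blast
      \<comment> \<open>\<open>D\<close> is affine in time, so the distortion between times
        \<open>s\<close> and \<open>t\<close> is \<open>\<bar>t - s\<bar>\<close> times that of
        \<open>R\<close>; \<open>?c\<close> is the radius with exactly this \<open>p\<close>-th
        power.\<close>
      have "mdist (W s) a a' powr p - mdist (W t) b b' powr p
          = (t - s) * (mdist X (fst z) (fst w) powr p - mdist Y (snd z) (snd w) powr p)"
        unfolding zw(3-6) dW[OF st(1) zw(1,2)] dW[OF st(2) zw(1,2)] D_def
        by (simp add: algebra_simps)
      moreover have "\<bar>t - s\<bar> * \<bar>mdist X (fst z) (fst w) powr p - mdist Y (snd z) (snd w) powr p\<bar>
          \<le> \<bar>t - s\<bar> * (2 * ?r powr p)"
        using zw by (intro mult_left_mono dis) auto
      ultimately show "\<bar>mdist (W s) a a' powr p - mdist (W t) b b' powr p\<bar> \<le> 2 * ?c powr p"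
        unfolding c by (simp add: abs_mult abs_minus_commute mult.left_commute)
    qed
    then have "?G s t powr p \<le> ?c powr p"
      using p GH_dist_nonneg[OF p W[OF st(1)] W[OF st(2)]] by (intro powr_mono2) auto
    then show ?thesis
      by (simp only: c)
  qed
  have eq: "?G s t = (t - s) powr (1 / p) * ?r" if st: "s \<in> {0..1}" "t \<in> {0..1}" "s \<le> t" for s t
  proof -
    have ends: "0 \<in> {0..1 :: real}" "1 \<in> {0..1 :: real}"
      by auto
    \<comment> \<open>The upper bounds for the three pieces carry weights \<open>s\<close>,
      \<open>t - s\<close> and \<open>1 - t\<close>, which add up to \<open>1\<close>, while
      \<open>?G 0 1 = ?r\<close>; slack in the middle piece is therefore impossible.\<close>
    have "?G 0 1 powr p \<le> ?G 0 s powr p + (?G s t powr p + ?G t 1 powr p)"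
      using GH_dist_triangle[OF p W[OF ends(1)] W[OF st(1)] W[OF ends(2)]]
        GH_dist_triangle[OF p W[OF st(1)] W[OF st(2)] W[OF ends(2)]] by linarith
    moreover have "?G 0 s powr p \<le> s * ?r powr p" "?G t 1 powr p \<le> (1 - t) * ?r powr p"
      using upper[OF ends(1) st(1)] upper[OF st(2) ends(2)] st by simp_all
    ultimately have "?G s t powr p \<ge> (t - s) * ?r powr p"
      unfolding W0 W1 by (simp add: algebra_simps)
    with upper[OF st(1,2)] st have "?G s t powr p = (t - s) * ?r powr p"
      by simp
    also have "\<dots> = ((t - s) powr (1 / p) * ?r) powr p"
      using p st GH_dist_nonneg[OF p X(1) Y(1)] by (simp add: powr_mult powr_powr)
    finally show ?thesis
      using GH_dist_nonneg[OF p X(1) Y(1)]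
      by (intro powr_powr_inverse[OF p GH_dist_nonneg[OF p W[OF st(1)] W[OF st(2)]]]) auto
  qed
  have eq': "?G s t = \<bar>s - t\<bar> powr (1 / p) * ?r" if st: "s \<in> {0..1}" "t \<in> {0..1}" for s t
  proof (cases "s \<le> t")
    case True
    then show ?thesis
      using eq[OF st] by simp
  next
    case False
    then show ?thesis
      using eq[OF st(2,1)] GH_dist_commute[OF p W[OF st(1)] W[OF st(2)]] by simp
  qed
  define \<gamma> where "\<gamma> = (\<lambda>t. {Z :: real metric. isometric (W t) Z})"
  have \<gamma>: "\<gamma> t \<in> isometry_classes p" if "t \<in> {0..1}" for t
    unfolding \<gamma>_def by (rule isometry_classes_memI[OF W[OF that]])
  have ends: "\<gamma> 0 = A" "\<gamma> 1 = B"
    unfolding \<gamma>_def W0 W1 isometry_classes_mem(2)[OF A X(2)] isometry_classes_mem(2)[OF B Y(2)]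
    by (rule refl)+
  have dist: "mdist (GH_space p) (\<gamma> s) (\<gamma> t) = \<bar>s - t\<bar> powr (1 / p) * ?r"
    if st: "s \<in> {0..1}" "t \<in> {0..1}" for s t
    unfolding mdist_GH_space[OF p] eq'[OF st, symmetric]
    by (rule GH_class_dist_eq[OF p \<gamma>[OF st(1)] _ \<gamma>[OF st(2)]]) (simp_all add: \<gamma>_def isometric_refl)
  have "continuous_map (top_of_set {0..1}) (mtopology_of (GH_space p)) \<gamma>"
    unfolding mtopology_of_def Metric_space.continuous_map_to_metric[OF Metric_space_mspace_mdist]
  proof (intro ballI allI impI)
    fix s e :: real assume "s \<in> topspace (top_of_set {0..1})" and e: "0 < e"
    then have s: "s \<in> {0..1}"
      by simp
    \<comment> \<open>The distance from \<open>\<gamma> s\<close> to \<open>\<gamma> t\<close> is a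
      continuous function of \<open>t\<close> that vanishes at \<open>s\<close>; the set where it is
      below \<open>e\<close> is the required neighbourhood.\<close>
    have "continuous_map (top_of_set {0..1}) euclideanreal (\<lambda>t. \<bar>s - t\<bar> powr (1 / p) * ?r)"
      using p by (auto intro!: continuous_intros continuous_on_powr')
    then have "openin (top_of_set {0..1})
        {t \<in> topspace (top_of_set {0..1}). \<bar>s - t\<bar> powr (1 / p) * ?r \<in> {..<e}}"
      by (rule openin_continuous_map_preimage) simp
    then show "\<exists>U. openin (top_of_set {0..1}) U \<and> s \<in> U \<and>
        (\<forall>t\<in>U. \<gamma> t \<in> Metric_space.mball (mspace (GH_space p)) (mdist (GH_space p)) (\<gamma> s) e)"
      using s e \<gamma>[folded mspace_GH_space[OF p]] by (intro exI conjI) (auto simp: dist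
          Metric_space.in_mball[OF Metric_space_mspace_mdist])
  qed
  then have "q_geodesic p (GH_space p) \<gamma>"
    using dist[of 0 1] dist unfolding q_geodesic_def by simp
  then show "\<exists>\<gamma>. q_geodesic p (GH_space p) \<gamma> \<and> \<gamma> 0 = A \<and> \<gamma> 1 = B"
    using ends by blast
qed

section \<open>Obstruction for exponents below \<open>p\<close>\<close>

text \<open>The obstruction lives in every \<open>p\<close>-metric space: on a
  \<open>q\<close>-geodesic with distinct ends, the midpoint is too close to both of them for the
  \<open>p\<close>-triangle inequality.\<close>

lemma p_metric_q_geodesic_constant:
  assumes W: "p_metric_space p W" and q: "0 < q" "q < p" and \<gamma>: "q_geodesic q W \<gamma>"
  shows "\<gamma> 0 = \<gamma> 1"
proof (rule ccontr)
  assume ne: "\<gamma> 0 \<noteq> \<gamma> 1"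
  let ?D = "mdist W (\<gamma> 0) (\<gamma> 1)"
  have mem: "\<gamma> t \<in> mspace W" if "t \<in> {0..1}" for t
    using \<gamma> that continuous_map_image_subset_topspace[of "top_of_set {0..1}" "mtopology_of W" \<gamma>]
    unfolding q_geodesic_def by auto
  have "?D \<noteq> 0"
    using ne mem Metric_space.zero[OF Metric_space_mspace_mdist, of "\<gamma> 0" W "\<gamma> 1"] by simp
  then have pos: "0 < ?D powr p"
    by simp
  have geo: "mdist W (\<gamma> s) (\<gamma> t) = \<bar>s - t\<bar> powr (1 / q) * ?D" if "s \<in> {0..1}" "t \<in> {0..1}" for s t
    using \<gamma> that unfolding q_geodesic_def by blast
  have half: "mdist W (\<gamma> 0) (\<gamma> (1/2)) = (1/2) powr (1/q) * ?D"
    "mdist W (\<gamma> (1/2)) (\<gamma> 1) = (1/2) powr (1/q) * ?D"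
    using geo[of 0 "1/2"] geo[of "1/2" 1] by simp_all
  have "?D powr p \<le> mdist W (\<gamma> 0) (\<gamma> (1/2)) powr p + mdist W (\<gamma> (1/2)) (\<gamma> 1) powr p"
    using W mem[of 0] mem[of "1/2"] mem[of 1] unfolding p_metric_space_def by simp
  also have "\<dots> = 2 * (1/2) powr (p/q) * ?D powr p"
    unfolding half by (simp add: powr_mult powr_powr)
  \<comment> \<open>Since \<open>p/q > 1\<close>, the power of \<open>1/2\<close> falls strictly
    below \<open>1/2\<close>.\<close>
  also have "\<dots> < 2 * (1/2) powr 1 * ?D powr p"
    using q pos by (intro mult_strict_right_mono mult_strict_left_mono powr_less_mono') auto
  finally show False
    by simp
qed

text \<open>The values \<open>0\<close> and \<open>1\<close> are fixed by taking powers, so the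
  discrete metric satisfies the triangle inequality for each exponent; finiteness gives
  compactness.\<close>

lemma discrete_compact_p_metric:
  assumes "finite S" "S \<noteq> {}" "0 < p"
  shows "metric (S, \<lambda>x y. if x = y then 0 else 1) \<in> compact_p_metrics p"
    and "mspace (metric (S, \<lambda>x y. if x = y then 0 else 1 :: real)) = S"
proof -
  interpret Metric_space S "\<lambda>x y. if x = y then 0 else 1 :: real"
    by unfold_locales auto
  have "compact_space (mtopology_of (metric (S, \<lambda>x y. if x = y then 0 else 1)))"
    unfolding compact_space_def by (rule finite_imp_compactin) (simp_all add: assms)
  then show "metric (S, \<lambda>x y. if x = y then 0 else 1) \<in> compact_p_metrics p"
    using assms by (simp add: compact_p_metrics_def p_metric_space_def)
  show "mspace (metric (S, \<lambda>x y. if x = y then 0 else 1 :: real)) = S"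
    by simp
qed

text \<open>Constant curves are \<open>q\<close>-geodesics, so a counterexample requires two
  different classes. A one-point and a two-point space serve, as an isometry preserves
  cardinality.\<close>

lemma isometry_classes_distinct:
  assumes "0 < p"
  obtains A B where "A \<in> isometry_classes p" "B \<in> isometry_classes p" "A \<noteq> B"
proof -
  let ?M = "\<lambda>S :: real set. metric (S, \<lambda>x y. if x = y then 0 else 1 :: real)"
  have "\<not> isometric (?M {0, 1}) (?M {0})"
    using bij_betw_same_card[of _ "{0 :: real, 1}" "{0 :: real}"] assms
    unfolding isometric_def by (auto simp: discrete_compact_p_metric(2)[where p = p])
  then have "{Z :: real metric. isometric (?M {0, 1}) Z} \<noteq> {Z. isometric (?M {0}) Z}"
    using isometric_refl[of "?M {0}"] by blast
  from that[OF isometry_classes_memI[OF discrete_compact_p_metric(1)]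
      isometry_classes_memI[OF discrete_compact_p_metric(1)] this] show ?thesis
    using assms by simp
qed

theorem theorem7p31:
  fixes p :: real
  assumes "1 \<le> p"
  shows "q_geodesic_space p (GH_space p) \<and>
         (\<forall>q. 1 \<le> q \<and> q < p \<longrightarrow> \<not> q_geodesic_space q (GH_space p)) \<and>
         (p > 1 \<longrightarrow> \<not> geodesic_space (GH_space p))"
proof -
  have "\<not> q_geodesic_space q (GH_space p)" if q: "1 \<le> q" "q < p" for q
  proof
    assume geo: "q_geodesic_space q (GH_space p)"
    obtain A B where AB: "A \<in> isometry_classes p" "B \<in> isometry_classes p" "A \<noteq> B"
      using isometry_classes_distinct[of p] assms by auto
    have "\<exists>\<gamma>. q_geodesic q (GH_space p) \<gamma> \<and> \<gamma> 0 = A \<and> \<gamma> 1 = B"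
      using geo AB(1,2) unfolding q_geodesic_space_def mspace_GH_space[OF assms] by blast
    then obtain \<gamma> where \<gamma>: "q_geodesic q (GH_space p) \<gamma>" "\<gamma> 0 = A" "\<gamma> 1 = B"
      by (elim exE conjE)
    have "0 < q"
      using q by linarith
    from p_metric_q_geodesic_constant[OF p_metric_space_GH_space[OF assms order_refl] this q(2) \<gamma>(1)]
    show False
      using \<gamma>(2,3) AB(3) by simp
  qed
  \<comment> \<open>The last conjunct is the instance \<open>q = 1\<close> of the second.\<close>
  then show ?thesis
    using GH_space_p_geodesic[OF assms] by simp
qed

end
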